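(* Let $N, M$ be positive integers with $M\ge N$, let $0<\epsilon<1/2$, let $\mathcal{F}'\subseteq \mathcal{F}(N,M)$, and let $\phi:\mathcal{F}'\to\{0,1\}$ be a symmetric property. Let $\phi'$ be the restriction of $\phi$ to functions $f:[N]\to[N]$, i.e. $\phi'$ is the partial function on $\mathcal{F}(N,N)$ that is defined at $f:[N]\to[N]$ exactly when $f$, viewed as a function $[N]\to[M]$ via $[N]\subseteq[M]$, lies in $\mathcal{F}'$, and in that case $\phi'(f)=\phi(f)$. Then the minimum degree of a polynomial in the variables $y_{ij}$, $i\in[N]$, $j\in[M]$, that $\epsilon$-approximates $\phi$ is equal to the minimum degree of a polynomial in the variables $y_{ij}$, $i\in[N]$, $j\in[N]$, that $\epsilon$-approximates $\phi'$.
   Context: $[k]=\{1,\dots,k\}$, and $\mathcal{F}(N,M)$ is the set of all functions $f:[N]\to[M]$. A property is a partial function on $\mathcal{F}(N,M)$ with values in $\{0,1\}$, i.e. a function $\phi:\mathcal{F}'\to\{0,1\}$ with $\mathcal{F}'\subseteq\mathcal{F}(N,M)$; $\phi(f)$ is undefined for $f\notin\mathcal{F}'$. It is symmetric if $\phi(f)=\phi(\sigma f\pi)$ for all $\pi\in S_N$, $\sigma\in S_M$, where $\sigma f\pi$ denotes the composition $\sigma\circ f\circ\pi$; for partial functions this means that $f\in\mathcal{F}'$ if and only if $\sigma f\pi\in\mathcal{F}'$, and the values agree when defined. A function $f:[N]\to[M]$ is encoded by $y=(y_{11},\dots,y_{NM})\in\{0,1\}^{NM}$ with $y_{ij}=1$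 if $f(i)=j$ and $y_{ij}=0$ otherwise. A real polynomial $P$ in the variables $y_{ij}$ ($i\in[N]$, $j\in[M]$) $\epsilon$-approximates $\phi$ if, for every $f\in\mathcal{F}(N,M)$ with corresponding $y$: (1) $\phi(f)=1$ implies $1-\epsilon\le P(y)\le 1$; (2) $\phi(f)=0$ implies $0\le P(y)\le\epsilon$; (3) if $\phi(f)$ is undefined then $0\le P(y)\le 1$. There is no condition on $P(y)$ when $y$ does not correspond to any $f$. The same definition with $M$ replaced by $N$ applies to $\phi'$. *)

theory Defs
  imports Complex_Main "HOL-Library.FuncSet" "HOL-Library.Poly_Mapping"
    "HOL-Combinatorics.Permutations"
begin

(* Functions [N] -> [M] are extensional functions (undefined outside [N]), so for N <= M the
   set funs N N is literally a subset of funs N M: regarding f : [N] -> [N] as a function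
   [N] -> [M] does not change f. *)
definition funs :: "nat \<Rightarrow> nat \<Rightarrow> (nat \<Rightarrow> nat) set" where
  "funs N M = {1..N} \<rightarrow>\<^sub>E {1..M}"

(* A property is a partial function; None means undefined, and the values 0 and 1 are
   False and True.  The equation below compares options: both sides are undefined, or both are
   defined with the same value. *)
definition symmetric_property :: "nat \<Rightarrow> nat \<Rightarrow> ((nat \<Rightarrow> nat) \<rightharpoonup> bool) \<Rightarrow> bool" where
  "symmetric_property N M \<phi> \<longleftrightarrow>
     (\<forall>\<pi> \<sigma> f. \<pi> permutes {1..N} \<longrightarrow> \<sigma> permutes {1..M} \<longrightarrow> f \<in> funs N M \<longrightarrow>
        \<phi> (restrict (\<sigma> \<circ> f \<circ> \<pi>) {1..N}) = \<phi> f)"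

(* Real polynomials with variables indexed by 'v: a monomial maps each variable to its exponent,
   a polynomial maps each monomial to its coefficient. *)
type_synonym 'v monomial = "'v \<Rightarrow>\<^sub>0 nat"
type_synonym 'v real_mpoly = "'v monomial \<Rightarrow>\<^sub>0 real"

definition mpoly_vars :: "'v real_mpoly \<Rightarrow> 'v set" where
  "mpoly_vars P = (\<Union>m\<in>Poly_Mapping.keys P. Poly_Mapping.keys m)"

definition monomial_degree :: "'v monomial \<Rightarrow> nat" where
  "monomial_degree m = (\<Sum>v\<in>Poly_Mapping.keys m. Poly_Mapping.lookup m v)"

(* The zero polynomial gets degree 0. *)
definition mpoly_degree :: "'v real_mpoly \<Rightarrow> nat" where
  "mpoly_degree P = Max (insert 0 (monomial_degree ` Poly_Mapping.keys P))"

definition mpoly_eval :: "('v \<Rightarrow> real) \<Rightarrow> 'v real_mpoly \<Rightarrow> real" where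
  "mpoly_eval y P =
     (\<Sum>m\<in>Poly_Mapping.keys P. Poly_Mapping.lookup P m *
        (\<Prod>v\<in>Poly_Mapping.keys m. y v ^ Poly_Mapping.lookup m v))"

definition encode :: "(nat \<Rightarrow> nat) \<Rightarrow> nat \<times> nat \<Rightarrow> real" where
  "encode f = (\<lambda>(i, j). if f i = j then 1 else 0)"

definition approximates ::
  "nat \<Rightarrow> nat \<Rightarrow> real \<Rightarrow> (nat \<times> nat) real_mpoly \<Rightarrow> ((nat \<Rightarrow> nat) \<rightharpoonup> bool) \<Rightarrow> bool" where
  "approximates N M \<epsilon> P \<phi> \<longleftrightarrow>
     mpoly_vars P \<subseteq> {1..N} \<times> {1..M} \<and>
     (\<forall>f\<in>funs N M.
        (\<phi> f = Some True \<longrightarrow> 1 - \<epsilon> \<le> mpoly_eval (encode f) P \<and> mpoly_eval (encode f) P \<le> 1) \<and>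
        (\<phi> f = Some False \<longrightarrow> 0 \<le> mpoly_eval (encode f) P \<and> mpoly_eval (encode f) P \<le> \<epsilon>) \<and>
        (\<phi> f = None \<longrightarrow> 0 \<le> mpoly_eval (encode f) P \<and> mpoly_eval (encode f) P \<le> 1))"

definition min_approx_degree ::
  "nat \<Rightarrow> nat \<Rightarrow> real \<Rightarrow> ((nat \<Rightarrow> nat) \<rightharpoonup> bool) \<Rightarrow> nat" where
  "min_approx_degree N M \<epsilon> \<phi> =
     (LEAST d. \<exists>P. approximates N M \<epsilon> P \<phi> \<and> mpoly_degree P = d)"

(* The minimum above ranges over a nonempty set: the sum of the monomials
   y_{1,f(1)} ... y_{N,f(N)} over all f with value 1 represents the property exactly. *)
lemma approximates_exists:
  assumes "0 < \<epsilon>" and "\<epsilon> < 1"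
  shows "\<exists>P. approximates N M \<epsilon> P \<phi>"
proof -
  define mon :: "(nat \<Rightarrow> nat) \<Rightarrow> (nat \<times> nat) monomial" where
    "mon f = (\<Sum>i\<in>{1..N}. Poly_Mapping.single (i, f i) 1)" for f
  define S where "S = {f \<in> funs N M. \<phi> f = Some True}"
  define P :: "(nat \<times> nat) real_mpoly" where
    "P = (\<Sum>m\<in>mon ` S. Poly_Mapping.single m 1)"
  have finS: "finite S" unfolding S_def funs_def by (simp add: finite_PiE)
  have lookup_mon: "Poly_Mapping.lookup (mon f) (i, j) = (if i \<in> {1..N} \<and> f i = j then 1 else 0)"
    for f i j
  proof -
    have "Poly_Mapping.lookup (mon f) (i, j) = (\<Sum>k\<in>{1..N}. if k = i then (if f i = j then 1 else 0) else 0)"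
      unfolding mon_def lookup_sum
      by (intro sum.cong) (auto simp: lookup_single when_def)
    then show ?thesis by (simp add: sum.delta)
  qed
  have keys_mon: "Poly_Mapping.keys (mon f) = (\<lambda>i. (i, f i)) ` {1..N}" for f
    by (auto simp: in_keys_iff lookup_mon split: if_splits)
  have lookup_P: "Poly_Mapping.lookup P m = (if m \<in> mon ` S then 1 else 0)" for m
  proof -
    have "Poly_Mapping.lookup P m = (\<Sum>k\<in>mon ` S. if k = m then 1 else 0)"
      unfolding P_def lookup_sum by (intro sum.cong) (auto simp: lookup_single when_def)
    then show ?thesis using finS by (simp add: sum.delta)
  qed
  have keys_P: "Poly_Mapping.keys P = mon ` S"
    by (auto simp: in_keys_iff lookup_P split: if_splits)
  have inj: "inj_on mon S"
  proof (rule inj_onI)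
    fix f g assume fg: "f \<in> S" "g \<in> S" "mon f = mon g"
    show "f = g"
    proof (rule PiE_ext)
      show "f \<in> {1..N} \<rightarrow>\<^sub>E {1..M}" "g \<in> {1..N} \<rightarrow>\<^sub>E {1..M}"
        using fg by (auto simp: S_def funs_def)
      fix i assume "i \<in> {1..N}"
      then show "f i = g i"
        by (metis fg(3) lookup_mon zero_neq_one)
    qed
  qed
  have eval: "mpoly_eval (encode g) P = (if g \<in> S then 1 else 0)" if g: "g \<in> funs N M" for g
  proof -
    have "mpoly_eval (encode g) P =
        (\<Sum>f\<in>S. \<Prod>v\<in>Poly_Mapping.keys (mon f). encode g v ^ Poly_Mapping.lookup (mon f) v)"
      unfolding mpoly_eval_def keys_P by (subst sum.reindex[OF inj]) (simp add: lookup_P)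
    also have "\<dots> = (\<Sum>f\<in>S. if f = g then 1 else 0)"
    proof (intro sum.cong refl)
      fix f assume f: "f \<in> S"
      have "(\<Prod>v\<in>Poly_Mapping.keys (mon f). encode g v ^ Poly_Mapping.lookup (mon f) v) =
          (\<Prod>i\<in>{1..N}. if g i = f i then 1 else 0 :: real)"
        unfolding keys_mon
        by (subst prod.reindex) (auto simp: inj_on_def lookup_mon encode_def intro: prod.cong)
      also have "\<dots> = (if f = g then 1 else 0)"
      proof (cases "f = g")
        case False
        then obtain i where "i \<in> {1..N}" "f i \<noteq> g i"
          using f g PiE_ext[of f "{1..N}" "\<lambda>_. {1..M}" g] by (auto simp: S_def funs_def)
        then have "(\<Prod>i\<in>{1..N}. if g i = f i then 1 else 0 :: real) = 0"
          by (intro prod_zero bexI[of _ i]) simp_all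
        with False show ?thesis by simp
      qed simp
      finally show "(\<Prod>v\<in>Poly_Mapping.keys (mon f). encode g v ^ Poly_Mapping.lookup (mon f) v) =
          (if f = g then 1 else 0)" .
    qed
    finally show ?thesis using finS by (simp add: sum.delta)
  qed
  have "mpoly_vars P \<subseteq> {1..N} \<times> {1..M}"
    unfolding mpoly_vars_def keys_P by (auto simp: keys_mon S_def funs_def PiE_iff)
  then have "approximates N M \<epsilon> P \<phi>"
    unfolding approximates_def using assms by (auto simp: eval) (auto simp: S_def)
  then show ?thesis ..
qed

end

theory Submission
  imports Defs
begin

text \<open>
  One direction discards the variables with second index above \<open>N\<close>.  For the other, let \<open>P\<close>
  approximate the restricted property.  Given \<open>f : [N] \<rightarrow> [M]\<close>, choose an \<open>N\<close>-element set \<open>D\<close>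
  with \<open>f [N] \<subseteq> D \<subseteq> [M]\<close> and average \<open>P\<close> over all functions \<open>\<tau>\<^sup>-\<^sup>1 \<circ> f\<close>, where \<open>\<tau>\<close> is a bijection
  \<open>[N] \<rightarrow> D\<close>.  By symmetry every term of the average lies in the interval prescribed for \<open>f\<close>.
  A monomial of \<open>P\<close> in which \<open>l\<close> distinct second indices \<open>B\<close> occur is the indicator of
  \<open>f i = \<tau> j\<close> for its variables \<open>y\<^sub>i\<^sub>j\<close>, so it only depends on the restriction of \<open>\<tau>\<close> to \<open>B\<close>, and
  every injection \<open>B \<rightarrow> D\<close> has \<open>(N - l)!\<close> extensions.  Its average is therefore
  \<open>(N - l)! / N!\<close> times the sum, over all injections \<open>\<beta> : B \<rightarrow> D\<close>, of the monomial in the variables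
  with indices \<open>(i, \<beta> j)\<close>.  Injections \<open>B \<rightarrow> [M]\<close> that leave \<open>D\<close> contribute 0, so the sum may be
  taken over all of these; it is then a polynomial of the same degree that is independent of \<open>f\<close>.
\<close>

subsection \<open>Polynomials\<close>

definition monomial_eval :: "('v \<Rightarrow> real) \<Rightarrow> 'v monomial \<Rightarrow> real" where
  "monomial_eval y m = (\<Prod>v\<in>Poly_Mapping.keys m. y v ^ Poly_Mapping.lookup m v)"

text \<open>Extra variables have exponent 0 and contribute a factor 1. This lets two monomials be
  compared over the union of their key sets.\<close>

lemma monomial_eval_superset:
  assumes "finite V" and "Poly_Mapping.keys m \<subseteq> V"
  shows "monomial_eval y m = (\<Prod>v\<in>V. y v ^ Poly_Mapping.lookup m v)"
  unfolding monomial_eval_def using assms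
  by (intro prod.mono_neutral_left) (auto simp: in_keys_iff)

lemma monomial_eval_zero [simp]: "monomial_eval y 0 = 1"
  by (simp add: monomial_eval_def)

lemma monomial_eval_single [simp]: "monomial_eval y (Poly_Mapping.single v k) = y v ^ k"
  by (subst monomial_eval_superset[of "{v}"]) (auto split: if_splits)

lemma monomial_eval_add: "monomial_eval y (a + b) = monomial_eval y a * monomial_eval y b"
proof -
  let ?V = "Poly_Mapping.keys a \<union> Poly_Mapping.keys b"
  have "finite ?V" by simp
  then show ?thesis
    using keys_add[of a b]
    by (simp add: monomial_eval_superset[of ?V] lookup_add power_add prod.distrib)
qed

lemma monomial_eval_sum: "monomial_eval y (\<Sum>x\<in>X. g x) = (\<Prod>x\<in>X. monomial_eval y (g x))"
  by (induction X rule: infinite_finite_induct) (simp_all add: monomial_eval_add)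

lemma monomial_degree_superset:
  assumes "finite V" and "Poly_Mapping.keys m \<subseteq> V"
  shows "monomial_degree m = (\<Sum>v\<in>V. Poly_Mapping.lookup m v)"
  unfolding monomial_degree_def using assms
  by (intro sum.mono_neutral_left) (auto simp: in_keys_iff)

lemma monomial_degree_zero [simp]: "monomial_degree 0 = 0"
  by (simp add: monomial_degree_def)

lemma monomial_degree_single [simp]: "monomial_degree (Poly_Mapping.single v k) = k"
  by (subst monomial_degree_superset[of "{v}"]) (auto split: if_splits)

lemma monomial_degree_add: "monomial_degree (a + b) = monomial_degree a + monomial_degree b"
proof -
  let ?V = "Poly_Mapping.keys a \<union> Poly_Mapping.keys b"
  have "finite ?V" by simp
  then show ?thesis
    using keys_add[of a b]
    by (simp add: monomial_degree_superset[of ?V] lookup_add sum.distrib)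
qed

lemma monomial_degree_sum: "monomial_degree (\<Sum>x\<in>X. g x) = (\<Sum>x\<in>X. monomial_degree (g x))"
  by (induction X rule: infinite_finite_induct) (simp_all add: monomial_degree_add)

lemma mpoly_eval_superset:
  assumes "finite S" and "Poly_Mapping.keys P \<subseteq> S"
  shows "mpoly_eval y P = (\<Sum>m\<in>S. Poly_Mapping.lookup P m * monomial_eval y m)"
  unfolding mpoly_eval_def monomial_eval_def using assms
  by (intro sum.mono_neutral_left) (auto simp: in_keys_iff)

lemma mpoly_eval_zero [simp]: "mpoly_eval y 0 = 0"
  by (simp add: mpoly_eval_def)

lemma mpoly_eval_single [simp]:
  "mpoly_eval y (Poly_Mapping.single m c) = c * monomial_eval y m"
  by (subst mpoly_eval_superset[of "{m}"]) (auto split: if_splits)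

lemma mpoly_eval_add: "mpoly_eval y (P + Q) = mpoly_eval y P + mpoly_eval y Q"
proof -
  let ?S = "Poly_Mapping.keys P \<union> Poly_Mapping.keys Q"
  have "finite ?S" by simp
  then show ?thesis
    using keys_add[of P Q]
    by (simp add: mpoly_eval_superset[of ?S] lookup_add ring_distribs sum.distrib)
qed

lemma mpoly_eval_sum: "mpoly_eval y (\<Sum>x\<in>X. g x) = (\<Sum>x\<in>X. mpoly_eval y (g x))"
  by (induction X rule: infinite_finite_induct) (simp_all add: mpoly_eval_add)

lemma mpoly_degree_le_iff:
  "mpoly_degree P \<le> d \<longleftrightarrow> (\<forall>m\<in>Poly_Mapping.keys P. monomial_degree m \<le> d)"
  by (simp add: mpoly_degree_def)

lemma monomial_degree_le_mpoly_degree: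
  "m \<in> Poly_Mapping.keys P \<Longrightarrow> monomial_degree m \<le> mpoly_degree P"
  using mpoly_degree_le_iff[of P "mpoly_degree P"] by simp

lemma keys_sum_single:
  "Poly_Mapping.keys (\<Sum>x\<in>X. Poly_Mapping.single (g x) (c x)) \<subseteq> g ` X"
proof -
  have "Poly_Mapping.keys (\<Sum>x\<in>X. Poly_Mapping.single (g x) (c x))
      \<subseteq> (\<Union>x\<in>X. Poly_Mapping.keys (Poly_Mapping.single (g x) (c x)))"
    by (rule keys_sum)
  also have "\<dots> \<subseteq> g ` X" by (auto split: if_splits)
  finally show ?thesis .
qed

subsection \<open>Approximation\<close>

text \<open>All three cases become closed intervals, hence convex sets, which is the form that
  averaging uses.\<close>

definition approx_range :: "real \<Rightarrow> bool option \<Rightarrow> real set" where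
  "approx_range \<epsilon> v =
     (case v of None \<Rightarrow> {0..1} | Some b \<Rightarrow> if b then {1 - \<epsilon>..1} else {0..\<epsilon>})"

lemma approximates_iff:
  "approximates N M \<epsilon> P \<phi> \<longleftrightarrow> mpoly_vars P \<subseteq> {1..N} \<times> {1..M} \<and>
     (\<forall>f\<in>funs N M. mpoly_eval (encode f) P \<in> approx_range \<epsilon> (\<phi> f))"
proof -
  have "(v = Some True \<longrightarrow> 1 - \<epsilon> \<le> x \<and> x \<le> 1) \<and> (v = Some False \<longrightarrow> 0 \<le> x \<and> x \<le> \<epsilon>) \<and>
      (v = None \<longrightarrow> 0 \<le> x \<and> x \<le> 1) \<longleftrightarrow> x \<in> approx_range \<epsilon> v" for v x
    by (auto simp: approx_range_def split: option.splits)
  then show ?thesis by (simp add: approximates_def)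
qed

lemma average_mem_approx_range:
  assumes "finite S" and "S \<noteq> {}" and "\<And>x. x \<in> S \<Longrightarrow> g x \<in> approx_range \<epsilon> v"
  shows "(\<Sum>x\<in>S. g x) / real (card S) \<in> approx_range \<epsilon> v"
proof -
  have "\<exists>a b. approx_range \<epsilon> v = {a..b}"
    by (simp add: approx_range_def split: option.splits) blast
  then obtain a b where ab: "approx_range \<epsilon> v = {a..b}" by blast
  have "real (card S) * a \<le> (\<Sum>x\<in>S. g x)" "(\<Sum>x\<in>S. g x) \<le> real (card S) * b"
    using assms(3) by (auto simp: ab intro!: sum_bounded_below sum_bounded_above)
  moreover have "0 < real (card S)"
    using assms(1,2) by (simp add: card_gt_0_iff)
  ultimately show ?thesis by (simp add: ab field_simps)
qed

section \<open>Comparing minimum degrees, and shrinking the range\<close>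

text \<open>By \<open>approximates_exists\<close> the \<open>LEAST\<close> degree is attained, so it
  is enough to transform approximants without raising their degree.\<close>

lemma min_approx_degree_mono:
  assumes "0 < \<epsilon>" and "\<epsilon> < 1"
    and step: "\<And>P. approximates N M \<epsilon> P \<phi> \<Longrightarrow>
        \<exists>Q. approximates N' M' \<epsilon> Q \<phi>' \<and> mpoly_degree Q \<le> mpoly_degree P"
  shows "min_approx_degree N' M' \<epsilon> \<phi>' \<le> min_approx_degree N M \<epsilon> \<phi>"
proof -
  let ?A = "\<lambda>d. \<exists>P. approximates N M \<epsilon> P \<phi> \<and> mpoly_degree P = d"
  have "?A (LEAST d. ?A d)"
    by (rule LeastI_ex[where P = ?A]) (use approximates_exists[OF assms(1,2), of N M \<phi>] in blast)
  then obtain P where P: "approximates N M \<epsilon> P \<phi>" "mpoly_degree P = min_approx_degree N M \<epsilon> \<phi>"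
    by (auto simp: min_approx_degree_def)
  from step[OF P(1)] obtain Q
    where Q: "approximates N' M' \<epsilon> Q \<phi>'" "mpoly_degree Q \<le> mpoly_degree P" by blast
  have "min_approx_degree N' M' \<epsilon> \<phi>' \<le> mpoly_degree Q"
    unfolding min_approx_degree_def by (rule Least_le) (use Q(1) in blast)
  with Q(2) P(2) show ?thesis by simp
qed

text \<open>A monomial of \<open>P\<close> containing a variable with second index above
  \<open>K\<close> vanishes at every function into [K], so \<open>Q\<close> simply omits it.\<close>

lemma approximates_restrict_range:
  assumes "K \<le> M" and P: "approximates N M \<epsilon> P \<phi>"
  shows "\<exists>Q. approximates N K \<epsilon> Q (\<phi> |` funs N K) \<and> mpoly_degree Q \<le> mpoly_degree P"
proof -
  define S where "S = {m \<in> Poly_Mapping.keys P. Poly_Mapping.keys m \<subseteq> {1..N} \<times> {1..K}}"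
  define Q where "Q = (\<Sum>m\<in>S. Poly_Mapping.single m (Poly_Mapping.lookup P m))"
  have keys_Q: "Poly_Mapping.keys Q \<subseteq> S"
    using keys_sum_single[of "\<lambda>m. m"] by (simp add: Q_def)
  have vars_P: "mpoly_vars P \<subseteq> {1..N} \<times> {1..M}"
    using P by (simp add: approximates_iff)
  have eval: "mpoly_eval (encode f) Q = mpoly_eval (encode f) P" if f: "f \<in> funs N K" for f
  proof -
    have "monomial_eval (encode f) m = 0" if m: "m \<in> Poly_Mapping.keys P - S" for m
    proof -
      from m obtain i j where ij: "(i, j) \<in> Poly_Mapping.keys m" "(i, j) \<notin> {1..N} \<times> {1..K}"
        by (force simp add: S_def simp del: mem_Sigma_iff)
      moreover have "(i, j) \<in> {1..N} \<times> {1..M}"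
        using m ij(1) vars_P by (force simp: mpoly_vars_def)
      ultimately have "f i \<noteq> j"
        using f by (auto simp: funs_def PiE_iff)
      \<comment> \<open>A key has a positive exponent, so this power is not
        \<open>0 ^ 0 = 1\<close>.\<close>
      then have "encode f (i, j) ^ Poly_Mapping.lookup m (i, j) = 0"
        using ij(1) by (simp add: encode_def in_keys_iff)
      then show ?thesis
        unfolding monomial_eval_def using ij(1) by (intro prod_zero) auto
    qed
    then have "mpoly_eval (encode f) P = (\<Sum>m\<in>S. Poly_Mapping.lookup P m * monomial_eval (encode f) m)"
      unfolding mpoly_eval_superset[OF finite_keys subset_refl]
      by (intro sum.mono_neutral_right) (auto simp: S_def)
    then show ?thesis by (simp add: Q_def mpoly_eval_sum)
  qed
  have "funs N K \<subseteq> funs N M"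
    unfolding funs_def using assms(1) by (intro PiE_mono) auto
  then have "approximates N K \<epsilon> Q (\<phi> |` funs N K)"
    using P keys_Q unfolding approximates_iff
    by (auto simp: eval mpoly_vars_def S_def)
  moreover have "mpoly_degree Q \<le> mpoly_degree P"
    using keys_Q by (auto simp: mpoly_degree_le_iff S_def intro: monomial_degree_le_mpoly_degree)
  ultimately show ?thesis by blast
qed

subsection \<open>Counting injections\<close>

text \<open>Extensionality keeps the set finite and lets an injection on a subset be equal to the
  \<open>restrict\<close> of its extensions.\<close>

definition injections :: "'a set \<Rightarrow> 'b set \<Rightarrow> ('a \<Rightarrow> 'b) set" where
  "injections A D = {\<tau> \<in> A \<rightarrow>\<^sub>E D. inj_on \<tau> A}"

lemma finite_injections [simp]: "finite A \<Longrightarrow> finite D \<Longrightarrow> finite (injections A D)"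
  by (simp add: injections_def finite_PiE)

lemma card_injections_same_card:
  assumes "finite A" and "finite D" and "card A = card D"
  shows "card (injections A D) = fact (card A)"
  unfolding injections_def card_inj_on_subset_funcset[OF assms(1,2) subset_refl]
  using assms(3) by (simp add: fact_prod_rev)

text \<open>Extending \<beta> amounts to injecting \<open>A - B\<close> into the part of
  \<open>D\<close> that \<beta> misses; both sets have \<open>card A - card B\<close>
  elements.\<close>

lemma card_injection_extensions:
  assumes fin: "finite A" "finite D" and card: "card A = card D"
    and BA: "B \<subseteq> A" and \<beta>: "\<beta> \<in> injections B D"
  shows "card {\<tau> \<in> injections A D. restrict \<tau> B = \<beta>} = fact (card A - card B)"
proof -
  let ?glue = "\<lambda>\<rho> x. if x \<in> B then \<beta> x else \<rho> x"
  have finB: "finite B" using BA fin(1) by (rule finite_subset)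
  have \<beta>': "\<beta> \<in> B \<rightarrow>\<^sub>E D" "inj_on \<beta> B"
    using \<beta> by (auto simp: injections_def)
  have "bij_betw (\<lambda>\<tau>. restrict \<tau> (A - B))
      {\<tau> \<in> injections A D. restrict \<tau> B = \<beta>} (injections (A - B) (D - \<beta> ` B))"
  proof (rule bij_betw_byWitness[where f' = ?glue])
    show "\<forall>\<tau>\<in>{\<tau> \<in> injections A D. restrict \<tau> B = \<beta>}. ?glue (restrict \<tau> (A - B)) = \<tau>"
    proof (intro ballI ext)
      fix \<tau> x assume "\<tau> \<in> {\<tau> \<in> injections A D. restrict \<tau> B = \<beta>}"
      then have \<tau>: "\<tau> \<in> extensional A" and \<beta>_eq: "\<beta> = restrict \<tau> B"
        by (auto simp: injections_def PiE_iff)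
      \<comment> \<open>Outside \<open>A\<close> both sides are \<open>undefined\<close>.\<close>
      show "?glue (restrict \<tau> (A - B)) x = \<tau> x"
        using BA extensional_arb[OF \<tau>, of x] unfolding \<beta>_eq by auto
    qed
    show "\<forall>\<rho>\<in>injections (A - B) (D - \<beta> ` B). restrict (?glue \<rho>) (A - B) = \<rho>"
    proof (intro ballI ext)
      fix \<rho> x assume "\<rho> \<in> injections (A - B) (D - \<beta> ` B)"
      then have "\<rho> \<in> extensional (A - B)"
        by (auto simp: injections_def PiE_iff)
      from extensional_arb[OF this, of x] show "restrict (?glue \<rho>) (A - B) x = \<rho> x"
        by auto
    qed
    show "(\<lambda>\<tau>. restrict \<tau> (A - B)) ` {\<tau> \<in> injections A D. restrict \<tau> B = \<beta>}
        \<subseteq> injections (A - B) (D - \<beta> ` B)"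
    proof clarify
      fix \<tau> assume \<tau>: "\<tau> \<in> injections A D" and \<beta>_eq: "\<beta> = restrict \<tau> B"
      have "inj_on \<tau> A" and "\<tau> \<in> A \<rightarrow> D"
        using \<tau> by (auto simp: injections_def)
      moreover from this(1) have "\<tau> x \<notin> restrict \<tau> B ` B" if "x \<in> A - B" for x
        using that BA by (auto dest: inj_onD)
      moreover have "inj_on \<tau> (A - B)"
        using calculation(1) by (rule inj_on_subset) auto
      ultimately show "restrict \<tau> (A - B) \<in> injections (A - B) (D - restrict \<tau> B ` B)"
        by (auto simp: injections_def)
    qed
    show "?glue ` injections (A - B) (D - \<beta> ` B) \<subseteq> {\<tau> \<in> injections A D. restrict \<tau> B = \<beta>}"
    proof clarify
      fix \<rho> assume "\<rho> \<in> injections (A - B) (D - \<beta> ` B)"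
      then have \<rho>: "\<rho> \<in> A - B \<rightarrow> D - \<beta> ` B" "\<rho> \<in> extensional (A - B)" "inj_on \<rho> (A - B)"
        by (auto simp: injections_def PiE_iff)
      \<comment> \<open>The two pieces have disjoint images because \<rho> avoids the image of
        \<beta>.\<close>
      have "inj_on (?glue \<rho>) (B \<union> (A - B))"
        using \<beta>'(2) \<rho>(3) funcset_image[OF \<rho>(1)] by (intro inj_on_disjoint_Un) blast+
      then have "inj_on (?glue \<rho>) A"
        using BA by (simp add: Un_absorb1)
      moreover have "?glue \<rho> \<in> A \<rightarrow>\<^sub>E D"
        using \<rho>(1,2) \<beta>'(1) BA by (auto simp: PiE_iff extensional_def)
      moreover have "restrict (?glue \<rho>) B = \<beta>"
        using \<beta>'(1) by (intro ext) (auto simp: PiE_iff extensional_def)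
      ultimately show "?glue \<rho> \<in> injections A D \<and> restrict (?glue \<rho>) B = \<beta>"
        by (simp add: injections_def)
    qed
  qed
  then have "card {\<tau> \<in> injections A D. restrict \<tau> B = \<beta>} = card (injections (A - B) (D - \<beta> ` B))"
    by (rule bij_betw_same_card)
  moreover have "card (A - B) = card A - card B"
    using BA finB by (simp add: card_Diff_subset)
  moreover have "card (D - \<beta> ` B) = card D - card B"
    using \<beta>' finB by (subst card_Diff_subset) (auto simp: card_image PiE_iff)
  ultimately show ?thesis
    using fin card by (simp add: card_injections_same_card)
qed

text \<open>Group the injections by their restriction to \<open>B\<close>; all fibres have the same
  size.\<close>

lemma sum_injections_restrict:
  fixes h :: "('a \<Rightarrow> 'b) \<Rightarrow> real"
  assumes fin: "finite A" "finite D" and card: "card A = card D" and BA: "B \<subseteq> A"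
  shows "(\<Sum>\<tau>\<in>injections A D. h (restrict \<tau> B))
    = fact (card A - card B) * (\<Sum>\<beta>\<in>injections B D. h \<beta>)"
proof -
  have finB: "finite B" using BA fin(1) by (rule finite_subset)
  have "(\<lambda>\<tau>. restrict \<tau> B) ` injections A D \<subseteq> injections B D"
    using BA by (auto simp: injections_def PiE_iff intro: inj_on_subset)
  then have "(\<Sum>\<tau>\<in>injections A D. h (restrict \<tau> B)) = (\<Sum>\<beta>\<in>injections B D.
      \<Sum>\<tau>\<in>{\<tau> \<in> injections A D. restrict \<tau> B = \<beta>}. h (restrict \<tau> B))"
    using fin finB by (intro sum.group[symmetric]) auto
  also have "\<dots> = (\<Sum>\<beta>\<in>injections B D. fact (card A - card B) * h \<beta>)"
    by (intro sum.cong refl) (simp add: card_injection_extensions[OF fin card BA])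
  finally show ?thesis by (simp add: sum_distrib_left)
qed

subsection \<open>Averaging over relabellings of the range\<close>

text \<open>As a sum of one-variable monomials, it adds exponents when \<beta> merges variables, so
  the degree is preserved for every \<beta>.\<close>

definition relabel :: "(nat \<Rightarrow> nat) \<Rightarrow> (nat \<times> nat) monomial \<Rightarrow> (nat \<times> nat) monomial" where
  "relabel \<beta> m =
     (\<Sum>v\<in>Poly_Mapping.keys m. Poly_Mapping.single (fst v, \<beta> (snd v)) (Poly_Mapping.lookup m v))"

lemma keys_relabel:
  "Poly_Mapping.keys (relabel \<beta> m) \<subseteq> (\<lambda>v. (fst v, \<beta> (snd v))) ` Poly_Mapping.keys m"
  unfolding relabel_def by (rule keys_sum_single)

lemma monomial_degree_relabel [simp]: "monomial_degree (relabel \<beta> m) = monomial_degree m"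
  by (simp add: relabel_def monomial_degree_sum) (simp add: monomial_degree_def)

lemma monomial_eval_relabel:
  "monomial_eval y (relabel \<beta> m) =
     (\<Prod>v\<in>Poly_Mapping.keys m. y (fst v, \<beta> (snd v)) ^ Poly_Mapping.lookup m v)"
  by (simp add: relabel_def monomial_eval_sum)

text \<open>Puts the summand into the shape to which \<open>sum_injections_restrict\<close>
  applies.\<close>

lemma monomial_eval_relabel_restrict:
  "monomial_eval y (relabel (restrict \<tau> (snd ` Poly_Mapping.keys m)) m) =
     monomial_eval y (relabel \<tau> m)"
  by (simp add: monomial_eval_relabel)

text \<open>The factor is the proportion of bijections from [N] onto an N-element set that extend a
  given injection on the second indices of \<open>m\<close>.\<close>

definition range_average :: "nat \<Rightarrow> nat \<Rightarrow> (nat \<times> nat) real_mpoly \<Rightarrow> (nat \<times> nat) real_mpoly" where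
  "range_average N M P =
     (\<Sum>m\<in>Poly_Mapping.keys P. \<Sum>\<beta>\<in>injections (snd ` Poly_Mapping.keys m) {1..M}.
        Poly_Mapping.single (relabel \<beta> m)
          (Poly_Mapping.lookup P m * fact (N - card (snd ` Poly_Mapping.keys m)) / fact N))"

text \<open>Different pairs of \<open>m\<close> and \<beta> may give the same monomial and
  coefficients may cancel, so the keys are only bounded from above.\<close>

lemma keys_range_average:
  assumes "n \<in> Poly_Mapping.keys (range_average N M P)"
  obtains m \<beta> where "m \<in> Poly_Mapping.keys P"
    and "\<beta> \<in> injections (snd ` Poly_Mapping.keys m) {1..M}" and "n = relabel \<beta> m"
  using assms that unfolding range_average_def
  by (auto dest!: subsetD[OF keys_sum] split: if_splits)

lemma mpoly_degree_range_average: "mpoly_degree (range_average N M P) \<le> mpoly_degree P"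
  unfolding mpoly_degree_le_iff
  by (metis keys_range_average monomial_degree_relabel monomial_degree_le_mpoly_degree)

lemma mpoly_vars_range_average:
  assumes "mpoly_vars P \<subseteq> {1..N} \<times> {1..K}"
  shows "mpoly_vars (range_average N M P) \<subseteq> {1..N} \<times> {1..M}"
proof
  fix v assume "v \<in> mpoly_vars (range_average N M P)"
  then obtain n where n: "n \<in> Poly_Mapping.keys (range_average N M P)" "v \<in> Poly_Mapping.keys n"
    by (auto simp: mpoly_vars_def)
  from n(1) obtain m \<beta> where m: "m \<in> Poly_Mapping.keys P"
    and \<beta>: "\<beta> \<in> injections (snd ` Poly_Mapping.keys m) {1..M}" and "n = relabel \<beta> m"
    by (rule keys_range_average)
  with n(2) keys_relabel obtain u where u: "u \<in> Poly_Mapping.keys m" "v = (fst u, \<beta> (snd u))"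
    by blast
  have "u \<in> {1..N} \<times> {1..K}"
    using assms m u(1) by (auto simp: mpoly_vars_def)
  moreover have "\<beta> (snd u) \<in> {1..M}"
    using \<beta> u(1) by (auto simp: injections_def dest: PiE_mem)
  ultimately show "v \<in> {1..N} \<times> {1..M}"
    using u(2) by auto
qed

text \<open>The right side is an average, as there are N! bijections onto \<open>D\<close>. The left
  side does not mention \<open>D\<close>, so any N-element \<open>D\<close> containing the values of
  \<open>f\<close> may be chosen.\<close>

lemma mpoly_eval_range_average:
  assumes vars: "mpoly_vars P \<subseteq> {1..N} \<times> {1..N}" and f: "f \<in> {1..N} \<rightarrow> D"
    and D: "D \<subseteq> {1..M}" "card D = N"
  shows "mpoly_eval (encode f) (range_average N M P) =
    (\<Sum>\<tau>\<in>injections {1..N} D. mpoly_eval (\<lambda>(i, j). encode f (i, \<tau> j)) P) / fact N"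
proof -
  let ?B = "\<lambda>m. snd ` Poly_Mapping.keys m"
  have finD: "finite D" using D(1) finite_subset by blast
  have inner: "fact (N - card (?B m)) *
      (\<Sum>\<beta>\<in>injections (?B m) {1..M}. monomial_eval (encode f) (relabel \<beta> m)) =
      (\<Sum>\<tau>\<in>injections {1..N} D. monomial_eval (encode f) (relabel \<tau> m))"
    if m: "m \<in> Poly_Mapping.keys P" for m
  proof -
    have keys_m: "Poly_Mapping.keys m \<subseteq> {1..N} \<times> {1..N}"
      using m vars by (auto simp: mpoly_vars_def)
    have "monomial_eval (encode f) (relabel \<beta> m) = 0"
      if \<beta>: "\<beta> \<in> injections (?B m) {1..M} - injections (?B m) D" for \<beta>
    proof -
      \<comment> \<open>Since \<beta> is extensional and injective, it can fail to lie in the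
        smaller set only through a value outside \<open>D\<close>, which \<open>f\<close> never
        takes.\<close>
      from \<beta> obtain i j where ij: "(i, j) \<in> Poly_Mapping.keys m" "\<beta> j \<notin> D"
        by (auto simp: injections_def PiE_iff)
      moreover have "f i \<in> D"
        using ij(1) keys_m f by auto
      ultimately have "encode f (i, \<beta> j) ^ Poly_Mapping.lookup m (i, j) = 0"
        by (auto simp: encode_def in_keys_iff)
      then show ?thesis
        unfolding monomial_eval_relabel using ij(1) by (intro prod_zero bexI[of _ "(i, j)"]) auto
    qed
    moreover have "injections (?B m) D \<subseteq> injections (?B m) {1..M}"
      using D(1) by (auto simp: injections_def PiE_iff)
    ultimately have "(\<Sum>\<beta>\<in>injections (?B m) {1..M}. monomial_eval (encode f) (relabel \<beta> m)) =
        (\<Sum>\<beta>\<in>injections (?B m) D. monomial_eval (encode f) (relabel \<beta> m))"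
      by (intro sum.mono_neutral_right) auto
    moreover have "(\<Sum>\<tau>\<in>injections {1..N} D.
        monomial_eval (encode f) (relabel (restrict \<tau> (?B m)) m)) =
        fact (card {1..N} - card (?B m)) *
          (\<Sum>\<beta>\<in>injections (?B m) D. monomial_eval (encode f) (relabel \<beta> m))"
      using finD D(2) keys_m by (intro sum_injections_restrict) auto
    ultimately show ?thesis by (simp add: monomial_eval_relabel_restrict)
  qed
  have "mpoly_eval (encode f) (range_average N M P) =
      (\<Sum>m\<in>Poly_Mapping.keys P. Poly_Mapping.lookup P m / fact N * (fact (N - card (?B m)) *
        (\<Sum>\<beta>\<in>injections (?B m) {1..M}. monomial_eval (encode f) (relabel \<beta> m))))"
    by (simp add: range_average_def mpoly_eval_sum sum_distrib_left mult_ac)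
  also have "\<dots> = (\<Sum>m\<in>Poly_Mapping.keys P. Poly_Mapping.lookup P m / fact N *
      (\<Sum>\<tau>\<in>injections {1..N} D. monomial_eval (encode f) (relabel \<tau> m)))"
    by (intro sum.cong refl) (simp only: inner)
  also have "\<dots> = (\<Sum>m\<in>Poly_Mapping.keys P. \<Sum>\<tau>\<in>injections {1..N} D.
      Poly_Mapping.lookup P m * monomial_eval (encode f) (relabel \<tau> m)) / fact N"
    by (simp add: sum_distrib_left sum_divide_distrib)
  also have "\<dots> = (\<Sum>\<tau>\<in>injections {1..N} D. \<Sum>m\<in>Poly_Mapping.keys P.
      Poly_Mapping.lookup P m * monomial_eval (encode f) (relabel \<tau> m)) / fact N"
    by (subst sum.swap) simp
  finally show ?thesis
    by (simp add: mpoly_eval_def monomial_eval_relabel case_prod_beta)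
qed

section \<open>Enlarging the range from [N] to [M]\<close>

text \<open>The complements of \<open>A\<close> and of its image in \<open>S\<close> have equal
  cardinality, so a bijection between them completes \<tau>.\<close>

lemma injection_extends_to_permutation:
  assumes "finite S" and "A \<subseteq> S" and \<tau>: "inj_on \<tau> A" "\<tau> ` A \<subseteq> S"
  obtains \<sigma> where "\<sigma> permutes S" and "\<And>x. x \<in> A \<Longrightarrow> \<sigma> x = \<tau> x"
proof -
  have "card (\<tau> ` A) = card A"
    using \<tau>(1) by (rule card_image)
  then have "card (S - A) = card (S - \<tau> ` A)"
    using assms finite_subset[OF assms(2,1)] finite_subset[OF \<tau>(2) assms(1)]
    by (simp add: card_Diff_subset)
  then obtain h where h: "bij_betw h (S - A) (S - \<tau> ` A)"
    using assms(1) finite_same_card_bij[of "S - A" "S - \<tau> ` A"] by auto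
  define \<sigma> where "\<sigma> x = (if x \<in> S then if x \<in> A then \<tau> x else h x else x)" for x
  have "bij_betw (\<lambda>x. if x \<in> A then \<tau> x else h x) (A \<union> (S - A)) (\<tau> ` A \<union> (S - \<tau> ` A))"
    using \<tau>(1) h by (intro bij_betw_disjoint_Un) (auto simp: bij_betw_def)
  then have "bij_betw (\<lambda>x. if x \<in> A then \<tau> x else h x) S S"
    using assms(2) \<tau>(2) by (simp add: Un_absorb1)
  then have "bij_betw \<sigma> S S"
    by (rule bij_betw_cong[THEN iffD1, rotated]) (simp add: \<sigma>_def)
  then have "\<sigma> permutes S"
    by (rule bij_imp_permutes) (simp add: \<sigma>_def)
  moreover have "\<sigma> x = \<tau> x" if "x \<in> A" for x
    using that assms(2) by (auto simp: \<sigma>_def)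
  ultimately show thesis by (rule that)
qed

lemma approximates_extend_range:
  assumes NM: "N \<le> M" and sym: "symmetric_property N M \<phi>"
    and P: "approximates N N \<epsilon> P (\<phi> |` funs N N)"
  shows "approximates N M \<epsilon> (range_average N M P) \<phi>"
proof -
  have vars: "mpoly_vars P \<subseteq> {1..N} \<times> {1..N}"
    using P by (simp add: approximates_iff)
  have "mpoly_eval (encode f) (range_average N M P) \<in> approx_range \<epsilon> (\<phi> f)"
    if f: "f \<in> funs N M" for f
  proof -
    have "f ` {1..N} \<subseteq> {1..M}" and "card (f ` {1..N}) \<le> N"
      using f card_image_le[of "{1..N}" f] by (auto simp: funs_def PiE_iff)
    \<comment> \<open>\<open>f\<close> takes at most \<open>N\<close> values and \<open>N\<close>
      \<le> \<open>M\<close>, so an N-element set fits between its image and [M].\<close>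
    then obtain D where D: "f ` {1..N} \<subseteq> D" "D \<subseteq> {1..M}" "card D = N"
      using exists_subset_between[of "f ` {1..N}" N "{1..M}"] NM by auto
    have finD: "finite D" using D(2) finite_subset by blast
    have fD: "f \<in> {1..N} \<rightarrow> D" using D(1) by auto
    have "mpoly_eval (\<lambda>(i, j). encode f (i, \<tau> j)) P \<in> approx_range \<epsilon> (\<phi> f)"
      if "\<tau> \<in> injections {1..N} D" for \<tau>
    proof -
      have \<tau>: "inj_on \<tau> {1..N}" "\<tau> ` {1..N} \<subseteq> D"
        using that by (auto simp: injections_def PiE_iff)
      then have bij: "bij_betw \<tau> {1..N} D"
        using finD D(3) by (simp add: bij_betw_def card_image card_subset_eq)
      define g where "g = restrict (inv_into {1..N} \<tau> \<circ> f) {1..N}"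
      have \<tau>g: "\<tau> (g i) = f i" and gi: "g i \<in> {1..N}" if i: "i \<in> {1..N}" for i
      proof -
        have "f i \<in> D" using fD i by (rule funcset_mem)
        then show "\<tau> (g i) = f i" and "g i \<in> {1..N}"
          using i bij_betw_inv_into_right[OF bij] bij_betw_apply[OF bij_betw_inv_into[OF bij]]
          by (simp_all add: g_def)
      qed
      have g: "g \<in> funs N N"
        using gi by (auto simp: funs_def g_def)
      then have gM: "g \<in> funs N M"
        using NM by (auto simp: funs_def PiE_iff Pi_iff)
      \<comment> \<open>Symmetry speaks of permutations of \<open>{1..M}\<close>, so \<tau> is
        extended to one. It carries \<open>g\<close> to \<open>f\<close>, with the identity acting
        on the domain.\<close>
      obtain \<sigma> where \<sigma>: "\<sigma> permutes {1..M}" "\<And>x. x \<in> {1..N} \<Longrightarrow> \<sigma> x = \<tau> x"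
        using injection_extends_to_permutation[of "{1..M}" "{1..N}" \<tau>] \<tau> D(2) NM by auto
      have "restrict (\<sigma> \<circ> g \<circ> id) {1..N} = f"
        using f \<tau>g gi \<sigma>(2) by (fastforce simp: funs_def fun_eq_iff PiE_iff extensional_def)
      then have "\<phi> f = \<phi> g"
        using sym \<sigma>(1) gM permutes_id unfolding symmetric_property_def by metis
      moreover have "mpoly_eval (encode g) P \<in> approx_range \<epsilon> (\<phi> g)"
        using P g by (auto simp: approximates_iff)
      \<comment> \<open>The assignments are compared only on [N] x [N], which contains all variables
        of \<open>P\<close>; there injectivity of \<tau> makes them agree.\<close>
      moreover have "mpoly_eval (\<lambda>(i, j). encode f (i, \<tau> j)) P = mpoly_eval (encode g) P"
        unfolding mpoly_eval_def
      proof (intro sum.cong prod.cong refl arg_cong2[where f = "(*)"])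
        fix m v assume "m \<in> Poly_Mapping.keys P" "v \<in> Poly_Mapping.keys m"
        then obtain i j where v: "v = (i, j)" and ij: "i \<in> {1..N}" "j \<in> {1..N}"
          using vars by (cases v) (force simp: mpoly_vars_def)
        have "f i = \<tau> j \<longleftrightarrow> g i = j"
          using \<tau>g[OF ij(1)] gi[OF ij(1)] ij(2) inj_onD[OF \<tau>(1)] by metis
        then show "(case v of (i, j) \<Rightarrow> encode f (i, \<tau> j)) ^ Poly_Mapping.lookup m v =
            encode g v ^ Poly_Mapping.lookup m v"
          by (simp add: v encode_def)
      qed
      ultimately show ?thesis by simp
    qed
    moreover have "card (injections {1..N} D) = fact N"
      using finD D(3) by (simp add: card_injections_same_card)
    moreover from this have "injections {1..N} D \<noteq> {}"
      by (metis card.empty fact_nonzero)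
    ultimately show ?thesis
      using average_mem_approx_range[of "injections {1..N} D"] finD
      by (simp add: mpoly_eval_range_average[OF vars fD D(2,3)])
  qed
  with mpoly_vars_range_average[OF vars] show ?thesis
    by (simp add: approximates_iff)
qed

theorem theorem2:
  fixes N M :: nat and \<epsilon> :: real and F' :: "(nat \<Rightarrow> nat) set"
    and \<phi> \<phi>' :: "(nat \<Rightarrow> nat) \<rightharpoonup> bool"
  assumes "0 < N" and "0 < M" and "N \<le> M"
    and "0 < \<epsilon>" and "\<epsilon> < 1/2"
    and "F' \<subseteq> funs N M" and "dom \<phi> = F'"
    and "symmetric_property N M \<phi>"
    and "\<phi>' = \<phi> |` funs N N"
  shows "min_approx_degree N M \<epsilon> \<phi> = min_approx_degree N N \<epsilon> \<phi>'"
proof (rule antisym)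
  have \<epsilon>: "0 < \<epsilon>" "\<epsilon> < 1" using assms(4,5) by auto
  show "min_approx_degree N M \<epsilon> \<phi> \<le> min_approx_degree N N \<epsilon> \<phi>'"
    using \<epsilon> assms(3,8,9) approximates_extend_range mpoly_degree_range_average
    by (intro min_approx_degree_mono) blast+
  show "min_approx_degree N N \<epsilon> \<phi>' \<le> min_approx_degree N M \<epsilon> \<phi>"
    unfolding assms(9) using \<epsilon> approximates_restrict_range[OF assms(3)]
    by (rule min_approx_degree_mono)
qed

end
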